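(* Consider the mixed-integer optimization problem (MI) and its convex relaxation (CVX), both defined in the context. Let $\bm u^\circ$ be an optimal solution of (CVX), and let $\bm u^\star$ be the output of the two-stage method described in the context started from $\bm u^\circ$, with $\tilde{\bm\psi}$ the recomputed pressure vector, i.e. a minimizer over the box $[\underline{\bm\psi},\overline{\bm\psi}]$ of $$J_\psi(\bm\psi)=\max_{(i,j)\in\mathcal P^{\mathrm{nt}}}\Big|(2\tilde\delta^{\psi}_{(i,j)}-1)(\psi_i-\psi_j)-\sum_{m=1}^r\tilde\delta^m_{(i,j)}\big(a^m_{(i,j)}\phi^\circ_{(i,j)}+b^m_{(i,j)}\big)\Big| .$$ If the optimal value of this minimization problem is zero, i.e. $J_\psi(\tilde{\bm\psi})=0$, then $\bm u^\star$ is a solution (i.e. a feasible point attaining the minimum cost) of (MI).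
   Context: **Data.** - Power side. $\mathcal I^{\mathrm{dg}}$ is a finite set of dispatchable generators, the disjoint union of the gas-fueled units $\mathcal I^{\mathrm{gu}}$ and the non-gas-fueled units $\mathcal I^{\mathrm{ngu}}$. $(\mathcal B,\mathcal L)$ is a finite undirected connected graph (busses and power lines) with line reactances $X_{\{i,j\}}$. For a bus $i$, $\mathcal N_i^{\mathrm e}=\{j\mid\{i,j\}\in\mathcal L\}$, $\mathcal I_i^{\mathrm{dg}}$ is the set of generators connected to bus $i$, and $d_i^{\mathrm e}\ge 0$ is the electricity demand. - Gas side. $\mathcal I^{\mathrm{gs}}$ is a finite set of gas sources. $(\mathcal N,\mathcal P)$ is a finite connected directed graph (gas nodes and pipelines) in which each pipeline between $i$ and $j$ is represented by both edges $(i,j),(j,i)\in\mathcal P$. For a gas node $i$, $\mathcal N_i^{\mathrm g}=\{j\mid(i,j)\in\mathcal P\}$, $\mathcal I_i^{\mathrm{gs}}$ is the set of gas sources at $i$, $\mathcal I_i^{\mathrm{gu}}$ is the set of gas-fueled units connected to $i$, and $d_i^{\mathrm g}$ is the gas demand. - Areas. $\mathcal B$ and $\mathcal N$ are partitioned into $m_{\mathrm{areas}}$ areas $\mathcal B_a$, $\mathcal N_a$, with $|\mathcal N_a|>1$. $\mathcal P^{\mathrm t}\subset\mathcal P$ is the set of tie pipelines (connecting two different areas) and $\mathcal P^{\mathrm{nt}}=\mathcal P\setminus\mathcal P^{\mathrm t}$ is the set of internal pipelines. - Constants. Bounds $\underline p_i^{\mathrm{dg}}<\overline p_i^{\mathrm{dg}}$,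 $\underline\theta_i<\overline\theta_i$, $\underline g_i^{\mathrm s}<\overline g_i^{\mathrm s}$, $\underline\psi_i<\overline\psi_i$, and $\overline\phi_{(i,j)}$ (maximum gas flow); coefficients $\eta_{2,i}>0$, $\eta_{1,i},\eta_{0,i}\in\mathbb R$ ($i\in\mathcal I^{\mathrm{gu}}$); cost coefficients $c_{2,i}^{\mathrm{dg}}>0$, $c_{1,i}^{\mathrm{dg}},c_{0,i}^{\mathrm{dg}}\in\mathbb R$ ($i\in\mathcal I^{\mathrm{ngu}}$) and $c_{1,i}^{\mathrm{gs}},c_{0,i}^{\mathrm{gs}}\ge0$ ($i\in\mathcal I^{\mathrm{gs}}$). - Piecewise affine model. A number $r$ of pieces and, for each $(i,j)\in\mathcal P^{\mathrm{nt}}$, breakpoints $-\overline\phi_{(i,j)}=\underline\phi^1_{(i,j)}<\overline\phi^1_{(i,j)}=\underline\phi^2_{(i,j)}<\dots<\overline\phi^r_{(i,j)}=\overline\phi_{(i,j)}$ and coefficients $a^m_{(i,j)},b^m_{(i,j)}\in\mathbb R$, $m=1,\dots,r$. The function equal to $a^m_{(i,j)}\phi+b^m_{(i,j)}$ on the $m$-th piece serves as an approximation of $\phi^2/(c^{\mathrm f}_{(i,j)})^2$, where $c^{\mathrm f}_{(i,j)}$ is the Weymouth constant of the pipeline. $\varepsilon>0$ is a small tolerance. **Decision variables.** $\bm u$ collects $p_i^{\mathrm{dg}}\ge0$, $d_i^{\mathrm{gu}}\ge0$ ($i\in\mathcal I^{\mathrm{dg}}$); $\theta_i\in\mathbb R$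 ($i\in\mathcal B$); $g_i^{\mathrm s}\ge0$ ($i\in\mathcal I^{\mathrm{gs}}$); $\phi_{(i,j)}\in\mathbb R$ ($(i,j)\in\mathcal P^{\mathrm t}$); and, for $(i,j)\in\mathcal P^{\mathrm{nt}}$, the continuous vector $y_{(i,j)}=(\psi_i,\psi_j,\phi_{(i,j)},y^{\psi_i}_{(i,j)},\{y^m_{(i,j)}\}_{m=1}^r)\in\mathbb R^{4+r}$ and the vector $z_{(i,j)}=(\delta^\psi_{(i,j)},\{\alpha^m_{(i,j)},\beta^m_{(i,j)},\delta^m_{(i,j)}\}_{m=1}^r)$ of length $1+3r$. Here $\psi_i$ is the pressure at gas node $i$ (a single variable shared by all edges at $i$). **Problem (MI).** Minimize $$\sum_{i\in\mathcal I^{\mathrm{ngu}}}\big(c_{2,i}^{\mathrm{dg}}(p_i^{\mathrm{dg}})^2+c_{1,i}^{\mathrm{dg}}p_i^{\mathrm{dg}}+c_{0,i}^{\mathrm{dg}}\big)+\sum_{i\in\mathcal I^{\mathrm{gs}}}\big(c_{1,i}^{\mathrm{gs}}g_i^{\mathrm s}+c_{0,i}^{\mathrm{gs}}\big)$$ over $\bm u$ subject to $z_{(i,j)}\in\{0,1\}^{1+3r}$ for all $(i,j)\in\mathcal P^{\mathrm{nt}}$ and the following constraints. (a) $\underline p_i^{\mathrm{dg}}\le p_i^{\mathrm{dg}}\le\overline p_i^{\mathrm{dg}}$ for $i\in\mathcal I^{\mathrm{dg}}$; $d_i^{\mathrm{gu}}\ge\eta_{2,i}(p_i^{\mathrm{dg}})^2+\eta_{1,i}p_i^{\mathrm{dg}}+\eta_{0,i}$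 for $i\in\mathcal I^{\mathrm{gu}}$; $d_i^{\mathrm{gu}}=0$ for $i\in\mathcal I^{\mathrm{ngu}}$. (b) $\sum_{j\in\mathcal I_i^{\mathrm{dg}}}p_j^{\mathrm{dg}}-d_i^{\mathrm e}=\sum_{j\in\mathcal N_i^{\mathrm e}}\frac{1}{X_{\{i,j\}}}(\theta_i-\theta_j)$ and $\underline\theta_i\le\theta_i\le\overline\theta_i$ for $i\in\mathcal B$. (c) $\underline g_i^{\mathrm s}\le g_i^{\mathrm s}\le\overline g_i^{\mathrm s}$ for $i\in\mathcal I^{\mathrm{gs}}$. (d) $\sum_{j\in\mathcal I_i^{\mathrm{gs}}}g_j^{\mathrm s}-d_i^{\mathrm g}-\sum_{j\in\mathcal I_i^{\mathrm{gu}}}d_j^{\mathrm{gu}}=\sum_{j\in\mathcal N_i^{\mathrm g}}\phi_{(i,j)}$ for $i\in\mathcal N$. (e) $\phi_{(i,j)}+\phi_{(j,i)}=0$ and $-\overline\phi_{(i,j)}\le\phi_{(i,j)}\le\overline\phi_{(i,j)}$ for $(i,j)\in\mathcal P^{\mathrm t}$; $\underline\psi_i\le\psi_i\le\overline\psi_i$ for $i\in\mathcal N$. (f) Equality part of the gas flow model, for all $(i,j)\in\mathcal P^{\mathrm{nt}}$: $\sum_{m=1}^r(a^m_{(i,j)}y^m_{(i,j)}+b^m_{(i,j)}\delta^m_{(i,j)})=2y^{\psi_i}_{(i,j)}+2y^{\psi_j}_{(j,i)}-\psi_i-\psi_j$; $\ \phi_{(i,j)}+\phi_{(j,i)}=0$;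 $\ \sum_{m=1}^r\delta^m_{(i,j)}=1$. The first equation is the linear form, obtained with $y^m_{(i,j)}=\delta^m_{(i,j)}\phi_{(i,j)}$, $y^{\psi_i}_{(i,j)}=\delta^\psi_{(i,j)}\psi_i$ and $\delta^\psi_{(i,j)}=1-\delta^\psi_{(j,i)}$, of the gas flow equation $\sum_{m=1}^r\delta^m_{(i,j)}(a^m_{(i,j)}\phi_{(i,j)}+b^m_{(i,j)})=(2\delta^\psi_{(i,j)}-1)(\psi_i-\psi_j)$. (g) Inequality part of the gas flow model, for all $(i,j)\in\mathcal P^{\mathrm{nt}}$ and $m=1,\dots,r$ (edge subscripts on $\phi,\delta,\alpha,\beta,y$ and their bounds are all $(i,j)$ and are omitted): 1. $-\psi_i+\psi_j\le-(\underline\psi_i-\overline\psi_j)(1-\delta^\psi)$, $\ -\psi_i+\psi_j\ge\varepsilon+(-(\overline\psi_i-\underline\psi_j)-\varepsilon)\delta^\psi$; this encodes $[\delta^\psi=1]\Leftrightarrow[\psi_i\ge\psi_j]$. 2. $-\phi\le\overline\phi(1-\delta^\psi)$, $\ -\phi\ge\varepsilon+(-\overline\phi-\varepsilon)\delta^\psi$; this encodes $[\delta^\psi=1]\Leftrightarrow[\phi\ge0]$. 3. $\phi-\overline\phi^m\le(\overline\phi-\overline\phi^m)(1-\alpha^m)$, $\ \phi-\overline\phi^m\ge\varepsilon+(-\overline\phi-\overline\phi^m-\varepsilon)\alpha^m$, $\ -\phi+\underline\phi^m\le(\overline\phi+\underline\phi^m)(1-\beta^m)$, $\ -\phi+\underline\phi^m\ge\varepsilon+(-\overline\phi+\underline\phi^m-\varepsilon)\beta^m$,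 $\ -\alpha^m+\delta^m\le0$, $\ -\beta^m+\delta^m\le0$, $\ \alpha^m+\beta^m-\delta^m\le1$; this encodes $[\delta^m=1]\Leftrightarrow[\underline\phi^m\le\phi\le\overline\phi^m]$. 4. $y^m\ge-\overline\phi\,\delta^m$, $\ y^m\le\phi+\overline\phi(1-\delta^m)$, $\ y^m\le\overline\phi\,\delta^m$, $\ y^m\ge\phi-\overline\phi(1-\delta^m)$; this encodes $y^m=\delta^m\phi$. 5. $y^{\psi_i}\ge\underline\psi_i\delta^\psi$, $\ y^{\psi_i}\le\psi_i-\underline\psi_i(1-\delta^\psi)$, $\ y^{\psi_i}\le\overline\psi_i\delta^\psi$, $\ y^{\psi_i}\ge\psi_i-\overline\psi_i(1-\delta^\psi)$; this encodes $y^{\psi_i}=\delta^\psi\psi_i$. Standing convention: for binary values of $z_{(i,j)}$, each of these groups of inequalities is regarded as equivalent to the logical or product condition it encodes (the tolerance $\varepsilon$ is taken small enough for the values of the variables that occur). **Problem (CVX).** The same problem as (MI), with $z_{(i,j)}\in\{0,1\}^{1+3r}$ replaced by $z_{(i,j)}\in[0,1]^{1+3r}$ for all $(i,j)\in\mathcal P^{\mathrm{nt}}$. **Two-stage method.** *Stage 1.* Compute an optimal solution $\bm u^\circ$ of (CVX); its components carry the superscript $\circ$. *Stage 2.* (i) For each $(i,j)\in\mathcal P^{\mathrm{nt}}$, obtain from $\phi^\circ_{(i,j)}$ the binary vector $\tilde z_{(i,j)}=(\tilde\delta^\psi_{(i,j)},\{\tilde\alpha^m_{(i,j)},\tilde\beta^m_{(i,j)},\tilde\delta^m_{(i,j)}\}_{m=1}^r)$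 by using the constraints relating $z_{(i,j)}$ to the flow: $\tilde\delta^\psi_{(i,j)}=1$ if $\phi^\circ_{(i,j)}\ge0$ and $0$ otherwise; $\tilde\delta^m_{(i,j)}=1$ if $\underline\phi^m_{(i,j)}\le\phi^\circ_{(i,j)}\le\overline\phi^m_{(i,j)}$ and $0$ otherwise; and $\tilde\alpha^m_{(i,j)},\tilde\beta^m_{(i,j)}\in\{0,1\}$ such that $-\tilde\alpha^m+\tilde\delta^m\le0$, $-\tilde\beta^m+\tilde\delta^m\le0$, $\tilde\alpha^m+\tilde\beta^m-\tilde\delta^m\le1$ and the remaining inequalities of group (g)3 hold with $\phi=\phi^\circ_{(i,j)}$. (ii) Compute $\tilde{\bm\psi}=(\tilde\psi_i)_{i\in\mathcal N}$, a minimizer of $J_\psi(\bm\psi)$ (defined in the claim) over $\bm\psi\in[\underline{\bm\psi},\overline{\bm\psi}]$, i.e. over $\underline\psi_i\le\psi_i\le\overline\psi_i$ for all $i\in\mathcal N$. (iii) Set $\tilde y^{\psi_i}_{(i,j)}=\tilde\delta^\psi_{(i,j)}\tilde\psi_i$ and $\tilde y^m_{(i,j)}=\tilde\delta^m_{(i,j)}\phi^\circ_{(i,j)}$ for all $(i,j)\in\mathcal P^{\mathrm{nt}}$, $m=1,\dots,r$. *Output.* $\bm u^\star$ consists of $(p_i^{\mathrm{dg}})^\circ,(d_i^{\mathrm{gu}})^\circ$ ($i\in\mathcal I^{\mathrm{dg}}$), $\theta_i^\circ$ ($i\in\mathcal B$), $(g_i^{\mathrm s})^\circ$ ($i\in\mathcal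 I^{\mathrm{gs}}$), $\phi^\circ_{(i,j)}$ ($(i,j)\in\mathcal P^{\mathrm t}$), and, for $(i,j)\in\mathcal P^{\mathrm{nt}}$, $y^\star_{(i,j)}=(\tilde\psi_i,\tilde\psi_j,\phi^\circ_{(i,j)},\tilde y^{\psi_i}_{(i,j)},\{\tilde y^m_{(i,j)}\}_{m=1}^r)$ and $\tilde z_{(i,j)}$.
   Formalization: On internal pipelines it is additionally assumed that the flow φ° is nonzero and not at an interior breakpoint, and that the piecewise affine value at φ° is positive; without these the claim fails. "ε small enough" is made explicit at the values φ° and ψ̃. *)

theory Defs
  imports Complex_Main
begin

text \<open>
  Type variables: generators \<open>'g\<close>, busses \<open>'b\<close>, gas sources \<open>'s\<close>, gas nodes \<open>'n\<close>.
  Index sets are explicit finite sets; function values are irrelevant outside their index sets.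
  The pieces of the piecewise affine model and the areas are numbered from 1.
\<close>

record ('g, 'b, 's, 'n) network =
  gas_units :: "'g set"
  nongas_units :: "'g set"
  busses :: "'b set"
  lines :: "'b set set"
  reactance :: "'b set \<Rightarrow> real"
  units_at :: "'b \<Rightarrow> 'g set"
  elec_demand :: "'b \<Rightarrow> real"
  sources :: "'s set"
  nodes :: "'n set"
  pipes :: "('n \<times> 'n) set"
  sources_at :: "'n \<Rightarrow> 's set"
  gas_units_at :: "'n \<Rightarrow> 'g set"
  gas_demand :: "'n \<Rightarrow> real"
  n_areas :: nat
  bus_area :: "nat \<Rightarrow> 'b set"
  node_area :: "nat \<Rightarrow> 'n set"
  p_min :: "'g \<Rightarrow> real"
  p_max :: "'g \<Rightarrow> real"
  theta_min :: "'b \<Rightarrow> real"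
  theta_max :: "'b \<Rightarrow> real"
  g_min :: "'s \<Rightarrow> real"
  g_max :: "'s \<Rightarrow> real"
  psi_min :: "'n \<Rightarrow> real"
  psi_max :: "'n \<Rightarrow> real"
  phi_max :: "'n \<times> 'n \<Rightarrow> real"
  eta2 :: "'g \<Rightarrow> real"
  eta1 :: "'g \<Rightarrow> real"
  eta0 :: "'g \<Rightarrow> real"
  cost_dg2 :: "'g \<Rightarrow> real"
  cost_dg1 :: "'g \<Rightarrow> real"
  cost_dg0 :: "'g \<Rightarrow> real"
  cost_gs1 :: "'s \<Rightarrow> real"
  cost_gs0 :: "'s \<Rightarrow> real"
  pieces :: nat
  piece_lo :: "'n \<times> 'n \<Rightarrow> nat \<Rightarrow> real"
  piece_hi :: "'n \<times> 'n \<Rightarrow> nat \<Rightarrow> real"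
  pwa_a :: "'n \<times> 'n \<Rightarrow> nat \<Rightarrow> real"
  pwa_b :: "'n \<times> 'n \<Rightarrow> nat \<Rightarrow> real"
  tol :: real

definition units :: "('g, 'b, 's, 'n) network \<Rightarrow> 'g set" where
  "units D = gas_units D \<union> nongas_units D"

definition tie_pipes :: "('g, 'b, 's, 'n) network \<Rightarrow> ('n \<times> 'n) set" where
  "tie_pipes D = {(i, j) \<in> pipes D. \<exists>a\<in>{1..n_areas D}. \<exists>b\<in>{1..n_areas D}.
     a \<noteq> b \<and> i \<in> node_area D a \<and> j \<in> node_area D b}"

definition int_pipes :: "('g, 'b, 's, 'n) network \<Rightarrow> ('n \<times> 'n) set" where
  "int_pipes D = pipes D - tie_pipes D"

definition is_network :: "('g, 'b, 's, 'n) network \<Rightarrow> bool" where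
  "is_network D \<longleftrightarrow>
     finite (gas_units D) \<and> finite (nongas_units D) \<and> gas_units D \<inter> nongas_units D = {} \<and>
     finite (busses D) \<and>
     (\<forall>l\<in>lines D. \<exists>i\<in>busses D. \<exists>j\<in>busses D. i \<noteq> j \<and> l = {i, j} \<and> reactance D l \<noteq> 0) \<and>
     (\<forall>i\<in>busses D. \<forall>j\<in>busses D. (i, j) \<in> {(x, y). {x, y} \<in> lines D}\<^sup>*) \<and>
     (\<forall>i\<in>busses D. units_at D i \<subseteq> units D \<and> elec_demand D i \<ge> 0) \<and>
     finite (sources D) \<and> finite (nodes D) \<and>
     pipes D \<subseteq> nodes D \<times> nodes D \<and> irrefl (pipes D) \<and> sym (pipes D) \<and>
     (\<forall>i\<in>nodes D. \<forall>j\<in>nodes D. (i, j) \<in> (pipes D)\<^sup>*) \<and>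
     (\<forall>i\<in>nodes D. sources_at D i \<subseteq> sources D \<and> gas_units_at D i \<subseteq> gas_units D) \<and>
     (\<Union>a\<in>{1..n_areas D}. bus_area D a) = busses D \<and>
     (\<Union>a\<in>{1..n_areas D}. node_area D a) = nodes D \<and>
     (\<forall>a\<in>{1..n_areas D}. bus_area D a \<noteq> {} \<and> card (node_area D a) > 1) \<and>
     (\<forall>a\<in>{1..n_areas D}. \<forall>b\<in>{1..n_areas D}. a \<noteq> b \<longrightarrow>
        bus_area D a \<inter> bus_area D b = {} \<and> node_area D a \<inter> node_area D b = {}) \<and>
     (\<forall>i\<in>units D. p_min D i < p_max D i) \<and>
     (\<forall>i\<in>busses D. theta_min D i < theta_max D i) \<and>
     (\<forall>i\<in>sources D. g_min D i < g_max D i) \<and>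
     (\<forall>i\<in>nodes D. psi_min D i < psi_max D i) \<and>
     (\<forall>i\<in>gas_units D. eta2 D i > 0) \<and>
     (\<forall>i\<in>nongas_units D. cost_dg2 D i > 0) \<and>
     (\<forall>i\<in>sources D. cost_gs1 D i \<ge> 0 \<and> cost_gs0 D i \<ge> 0) \<and>
     pieces D \<ge> 1 \<and>
     (\<forall>e\<in>int_pipes D.
        piece_lo D e 1 = - phi_max D e \<and> piece_hi D e (pieces D) = phi_max D e \<and>
        (\<forall>m\<in>{1..pieces D}. piece_lo D e m < piece_hi D e m) \<and>
        (\<forall>m\<in>{1..<pieces D}. piece_hi D e m = piece_lo D e (Suc m))) \<and>
     tol D > 0"

record zvec =
  dpsi :: real
  alpha :: "nat \<Rightarrow> real"
  beta :: "nat \<Rightarrow> real"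
  delta :: "nat \<Rightarrow> real"

text \<open>
  \<open>flow\<close> holds the variables of tie and of internal pipelines alike, and \<open>ypsi u (i, j)\<close> is the
  variable standing for the product of \<open>dpsi (zvar u (i, j))\<close> and \<open>psi u i\<close>.
\<close>

record ('g, 'b, 's, 'n) dvars =
  pdg :: "'g \<Rightarrow> real"
  dgu :: "'g \<Rightarrow> real"
  theta :: "'b \<Rightarrow> real"
  gs :: "'s \<Rightarrow> real"
  flow :: "'n \<times> 'n \<Rightarrow> real"
  psi :: "'n \<Rightarrow> real"
  ypsi :: "'n \<times> 'n \<Rightarrow> real"
  ym :: "'n \<times> 'n \<Rightarrow> nat \<Rightarrow> real"
  zvar :: "'n \<times> 'n \<Rightarrow> zvec"

definition cost :: "('g, 'b, 's, 'n) network \<Rightarrow> ('g, 'b, 's, 'n) dvars \<Rightarrow> real" where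
  "cost D u =
     (\<Sum>i\<in>nongas_units D. cost_dg2 D i * (pdg u i)\<^sup>2 + cost_dg1 D i * pdg u i + cost_dg0 D i)
     + (\<Sum>i\<in>sources D. cost_gs1 D i * gs u i + cost_gs0 D i)"

definition power_constraints ::
  "('g, 'b, 's, 'n) network \<Rightarrow> ('g, 'b, 's, 'n) dvars \<Rightarrow> bool" where
  "power_constraints D u \<longleftrightarrow>
     (\<forall>i\<in>units D. 0 \<le> pdg u i \<and> 0 \<le> dgu u i \<and> p_min D i \<le> pdg u i \<and> pdg u i \<le> p_max D i) \<and>
     (\<forall>i\<in>gas_units D. dgu u i \<ge> eta2 D i * (pdg u i)\<^sup>2 + eta1 D i * pdg u i + eta0 D i) \<and>
     (\<forall>i\<in>nongas_units D. dgu u i = 0) \<and>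
     (\<forall>i\<in>busses D.
        (\<Sum>j\<in>units_at D i. pdg u j) - elec_demand D i
          = (\<Sum>j\<in>{j. {i, j} \<in> lines D}. 1 / reactance D {i, j} * (theta u i - theta u j)) \<and>
        theta_min D i \<le> theta u i \<and> theta u i \<le> theta_max D i)"

definition psi_box :: "('g, 'b, 's, 'n) network \<Rightarrow> ('n \<Rightarrow> real) \<Rightarrow> bool" where
  "psi_box D \<psi> \<longleftrightarrow> (\<forall>i\<in>nodes D. psi_min D i \<le> \<psi> i \<and> \<psi> i \<le> psi_max D i)"

definition gas_constraints ::
  "('g, 'b, 's, 'n) network \<Rightarrow> ('g, 'b, 's, 'n) dvars \<Rightarrow> bool" where
  "gas_constraints D u \<longleftrightarrow>
     (\<forall>i\<in>sources D. 0 \<le> gs u i \<and> g_min D i \<le> gs u i \<and> gs u i \<le> g_max D i) \<and>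
     (\<forall>i\<in>nodes D.
        (\<Sum>j\<in>sources_at D i. gs u j) - gas_demand D i - (\<Sum>j\<in>gas_units_at D i. dgu u j)
          = (\<Sum>j\<in>{j. (i, j) \<in> pipes D}. flow u (i, j))) \<and>
     (\<forall>(i, j)\<in>tie_pipes D.
        flow u (i, j) + flow u (j, i) = 0 \<and>
        - phi_max D (i, j) \<le> flow u (i, j) \<and> flow u (i, j) \<le> phi_max D (i, j)) \<and>
     psi_box D (psi u)"

definition flow_equalities ::
  "('g, 'b, 's, 'n) network \<Rightarrow> ('g, 'b, 's, 'n) dvars \<Rightarrow> bool" where
  "flow_equalities D u \<longleftrightarrow> (\<forall>(i, j)\<in>int_pipes D.
     (\<Sum>m=1..pieces D. pwa_a D (i, j) m * ym u (i, j) m + pwa_b D (i, j) m * delta (zvar u (i, j)) m)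
       = 2 * ypsi u (i, j) + 2 * ypsi u (j, i) - psi u i - psi u j \<and>
     flow u (i, j) + flow u (j, i) = 0 \<and>
     (\<Sum>m=1..pieces D. delta (zvar u (i, j)) m) = 1)"

text \<open>
  The five groups of big-M inequalities. For binary \<open>z\<close> they encode, in this order,
  \<open>d = 1\<close> iff \<open>\<psi> i \<ge> \<psi> j\<close>; \<open>d = 1\<close> iff \<open>f \<ge> 0\<close>;
  \<open>delta z m = 1\<close> iff \<open>f\<close> lies in piece \<open>m\<close>; \<open>y = d * f\<close>; \<open>y = d * \<psi> i\<close>.
\<close>

definition pressure_sign ::
  "('g, 'b, 's, 'n) network \<Rightarrow> 'n \<times> 'n \<Rightarrow> ('n \<Rightarrow> real) \<Rightarrow> real \<Rightarrow> bool" where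
  "pressure_sign D = (\<lambda>(i, j) \<psi> d.
     - \<psi> i + \<psi> j \<le> - (psi_min D i - psi_max D j) * (1 - d) \<and>
     - \<psi> i + \<psi> j \<ge> tol D + (- (psi_max D i - psi_min D j) - tol D) * d)"

definition flow_sign :: "('g, 'b, 's, 'n) network \<Rightarrow> 'n \<times> 'n \<Rightarrow> real \<Rightarrow> real \<Rightarrow> bool" where
  "flow_sign D e f d \<longleftrightarrow>
     - f \<le> phi_max D e * (1 - d) \<and>
     - f \<ge> tol D + (- phi_max D e - tol D) * d"

definition piece_select ::
  "('g, 'b, 's, 'n) network \<Rightarrow> 'n \<times> 'n \<Rightarrow> nat \<Rightarrow> real \<Rightarrow> zvec \<Rightarrow> bool" where
  "piece_select D e m f z \<longleftrightarrow>
     f - piece_hi D e m \<le> (phi_max D e - piece_hi D e m) * (1 - alpha z m) \<and>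
     f - piece_hi D e m \<ge> tol D + (- phi_max D e - piece_hi D e m - tol D) * alpha z m \<and>
     - f + piece_lo D e m \<le> (phi_max D e + piece_lo D e m) * (1 - beta z m) \<and>
     - f + piece_lo D e m \<ge> tol D + (- phi_max D e + piece_lo D e m - tol D) * beta z m \<and>
     - alpha z m + delta z m \<le> 0 \<and>
     - beta z m + delta z m \<le> 0 \<and>
     alpha z m + beta z m - delta z m \<le> 1"

definition flow_product ::
  "('g, 'b, 's, 'n) network \<Rightarrow> 'n \<times> 'n \<Rightarrow> real \<Rightarrow> real \<Rightarrow> real \<Rightarrow> bool" where
  "flow_product D e f d y \<longleftrightarrow>
     y \<ge> - phi_max D e * d \<and>
     y \<le> f + phi_max D e * (1 - d) \<and>
     y \<le> phi_max D e * d \<and>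
     y \<ge> f - phi_max D e * (1 - d)"

definition pressure_product ::
  "('g, 'b, 's, 'n) network \<Rightarrow> 'n \<Rightarrow> ('n \<Rightarrow> real) \<Rightarrow> real \<Rightarrow> real \<Rightarrow> bool" where
  "pressure_product D i \<psi> d y \<longleftrightarrow>
     y \<ge> psi_min D i * d \<and>
     y \<le> \<psi> i - psi_min D i * (1 - d) \<and>
     y \<le> psi_max D i * d \<and>
     y \<ge> \<psi> i - psi_max D i * (1 - d)"

definition flow_inequalities ::
  "('g, 'b, 's, 'n) network \<Rightarrow> ('g, 'b, 's, 'n) dvars \<Rightarrow> bool" where
  "flow_inequalities D u \<longleftrightarrow> (\<forall>(i, j)\<in>int_pipes D.
     pressure_sign D (i, j) (psi u) (dpsi (zvar u (i, j))) \<and>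
     flow_sign D (i, j) (flow u (i, j)) (dpsi (zvar u (i, j))) \<and>
     (\<forall>m\<in>{1..pieces D}.
        piece_select D (i, j) m (flow u (i, j)) (zvar u (i, j)) \<and>
        flow_product D (i, j) (flow u (i, j)) (delta (zvar u (i, j)) m) (ym u (i, j) m)) \<and>
     pressure_product D i (psi u) (dpsi (zvar u (i, j))) (ypsi u (i, j)))"

definition zvec_in :: "('g, 'b, 's, 'n) network \<Rightarrow> real set \<Rightarrow> zvec \<Rightarrow> bool" where
  "zvec_in D S z \<longleftrightarrow> dpsi z \<in> S \<and>
     (\<forall>m\<in>{1..pieces D}. alpha z m \<in> S \<and> beta z m \<in> S \<and> delta z m \<in> S)"

definition feasible ::
  "('g, 'b, 's, 'n) network \<Rightarrow> real set \<Rightarrow> ('g, 'b, 's, 'n) dvars \<Rightarrow> bool" where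
  "feasible D S u \<longleftrightarrow>
     (\<forall>e\<in>int_pipes D. zvec_in D S (zvar u e)) \<and>
     power_constraints D u \<and> gas_constraints D u \<and> flow_equalities D u \<and> flow_inequalities D u"

definition optimal ::
  "('g, 'b, 's, 'n) network \<Rightarrow> real set \<Rightarrow> ('g, 'b, 's, 'n) dvars \<Rightarrow> bool" where
  "optimal D S u \<longleftrightarrow> feasible D S u \<and> (\<forall>v. feasible D S v \<longrightarrow> cost D u \<le> cost D v)"

definition MI_solution ::
  "('g, 'b, 's, 'n) network \<Rightarrow> ('g, 'b, 's, 'n) dvars \<Rightarrow> bool" where
  "MI_solution D u \<longleftrightarrow> optimal D {0, 1} u"

definition CVX_solution ::
  "('g, 'b, 's, 'n) network \<Rightarrow> ('g, 'b, 's, 'n) dvars \<Rightarrow> bool" where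
  "CVX_solution D u \<longleftrightarrow> optimal D {0..1} u"

definition recovered_binaries ::
  "('g, 'b, 's, 'n) network \<Rightarrow> ('n \<times> 'n \<Rightarrow> real) \<Rightarrow> ('n \<times> 'n \<Rightarrow> zvec) \<Rightarrow> bool" where
  "recovered_binaries D \<phi> z \<longleftrightarrow> (\<forall>e\<in>int_pipes D.
     dpsi (z e) = (if \<phi> e \<ge> 0 then 1 else 0) \<and>
     (\<forall>m\<in>{1..pieces D}.
        delta (z e) m = (if piece_lo D e m \<le> \<phi> e \<and> \<phi> e \<le> piece_hi D e m then 1 else 0) \<and>
        alpha (z e) m \<in> {0, 1} \<and> beta (z e) m \<in> {0, 1} \<and>
        piece_select D e m (\<phi> e) (z e)))"

text \<open>
  The terms are nonnegative, so \<open>insert 0\<close> only matters when there is no internal pipeline;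
  the maximum is then 0.
\<close>

definition J_psi ::
  "('g, 'b, 's, 'n) network \<Rightarrow> ('n \<times> 'n \<Rightarrow> real) \<Rightarrow> ('n \<times> 'n \<Rightarrow> zvec) \<Rightarrow> ('n \<Rightarrow> real) \<Rightarrow> real"
  where
  "J_psi D \<phi> z \<psi> = Max (insert 0 ((\<lambda>(i, j).
     \<bar>(2 * dpsi (z (i, j)) - 1) * (\<psi> i - \<psi> j)
       - (\<Sum>m=1..pieces D. delta (z (i, j)) m * (pwa_a D (i, j) m * \<phi> (i, j) + pwa_b D (i, j) m))\<bar>)
     ` int_pipes D))"

definition J_psi_minimizer ::
  "('g, 'b, 's, 'n) network \<Rightarrow> ('n \<times> 'n \<Rightarrow> real) \<Rightarrow> ('n \<times> 'n \<Rightarrow> zvec) \<Rightarrow> ('n \<Rightarrow> real) \<Rightarrow> bool"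
  where
  "J_psi_minimizer D \<phi> z \<psi> \<longleftrightarrow>
     psi_box D \<psi> \<and> (\<forall>\<psi>'. psi_box D \<psi>' \<longrightarrow> J_psi D \<phi> z \<psi> \<le> J_psi D \<phi> z \<psi>')"

definition two_stage_output ::
  "('g, 'b, 's, 'n) dvars \<Rightarrow> ('n \<times> 'n \<Rightarrow> zvec) \<Rightarrow> ('n \<Rightarrow> real) \<Rightarrow> ('g, 'b, 's, 'n) dvars" where
  "two_stage_output u z \<psi> = u\<lparr>
     psi := \<psi>,
     ypsi := (\<lambda>(i, j). dpsi (z (i, j)) * \<psi> i),
     ym := (\<lambda>e m. delta (z e) m * flow u e),
     zvar := z\<rparr>"

text \<open>
  The big-M groups replace each strict inequality by one with margin \<open>tol D\<close>; they are equivalent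
  to the conditions they encode when \<open>tol D\<close> does not exceed any positive gap that occurs.
\<close>

definition tol_small ::
  "('g, 'b, 's, 'n) network \<Rightarrow> ('n \<times> 'n \<Rightarrow> real) \<Rightarrow> ('n \<Rightarrow> real) \<Rightarrow> bool" where
  "tol_small D \<phi> \<psi> \<longleftrightarrow> (\<forall>(i, j)\<in>int_pipes D.
     (\<psi> i < \<psi> j \<longrightarrow> tol D \<le> \<psi> j - \<psi> i) \<and>
     (\<phi> (i, j) < 0 \<longrightarrow> tol D \<le> - \<phi> (i, j)) \<and>
     (\<forall>m\<in>{1..pieces D}.
        (piece_hi D (i, j) m < \<phi> (i, j) \<longrightarrow> tol D \<le> \<phi> (i, j) - piece_hi D (i, j) m) \<and>
        (\<phi> (i, j) < piece_lo D (i, j) m \<longrightarrow> tol D \<le> piece_lo D (i, j) m - \<phi> (i, j))))"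

text \<open>
  The linear form of the gas flow equation uses that \<open>dpsi\<close> takes complementary values on
  \<open>(i, j)\<close> and \<open>(j, i)\<close>, and exactly one \<open>delta\<close> must equal 1. Together with the encoded conditions
  this leaves no consistent binary vector for zero flow or for flow at an interior breakpoint.
\<close>

definition nondegenerate_flow ::
  "('g, 'b, 's, 'n) network \<Rightarrow> ('n \<times> 'n \<Rightarrow> real) \<Rightarrow> bool" where
  "nondegenerate_flow D \<phi> \<longleftrightarrow>
     (\<forall>e\<in>int_pipes D. \<phi> e \<noteq> 0 \<and> (\<forall>m\<in>{1..<pieces D}. \<phi> e \<noteq> piece_hi D e m))"

text \<open>
  The piecewise affine function approximates the flow squared over the squared Weymouth constant;
  like that quantity, it is to be positive at the (nonzero) flows that occur. Otherwise the gas
  flow equation would contradict the pressure order encoded by \<open>dpsi\<close>.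
\<close>

definition pwa_positive_at ::
  "('g, 'b, 's, 'n) network \<Rightarrow> ('n \<times> 'n \<Rightarrow> real) \<Rightarrow> bool" where
  "pwa_positive_at D \<phi> \<longleftrightarrow> (\<forall>e\<in>int_pipes D. \<forall>m\<in>{1..pieces D}.
     piece_lo D e m \<le> \<phi> e \<and> \<phi> e \<le> piece_hi D e m \<longrightarrow> 0 < pwa_a D e m * \<phi> e + pwa_b D e m)"

end

theory Submission
  imports Defs
begin

text \<open>
  The two-stage output has the same cost as the relaxed optimum, and binary feasible points are
  feasible for the relaxation, so only its feasibility is at stake. The power, source and nodal
  balance constraints do not involve what the second stage changes. A nonzero flow reverses sign
  with the edge, so the recovered flow signs on \<open>(i, j)\<close> and \<open>(j, i)\<close> are complementary; hence
  \<open>J_psi = 0\<close> is exactly the linear form of the gas flow equation. A flow that is no interior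
  breakpoint lies in exactly one piece, so the right-hand side of that equation is one positive
  affine value, which forces the new pressures to be ordered as the flow sign prescribes.
\<close>

text \<open>This serves two ends: two different pieces share at most a breakpoint, and the last
  piece lies to the right of the first.\<close>

lemma consecutive_intervals_ordered:
  fixes lo hi :: "nat \<Rightarrow> real"
  assumes "\<forall>m\<in>{1..r}. lo m < hi m" "\<forall>m\<in>{1..<r}. hi m = lo (Suc m)"
    and "1 \<le> k" "k < m" "m \<le> r"
  shows "hi k \<le> lo m"
  using \<open>k < m\<close> \<open>m \<le> r\<close>
proof (induction m)
  case 0
  then show ?case by simp
next
  case (Suc m)
  show ?case
  proof (cases "k = m")
    case True
    then show ?thesis using assms(2,3) Suc.prems by auto
  next
    case False
    then have "hi k \<le> lo m" using Suc by simp
    also have "lo m < hi m" using assms(1,3) Suc.prems by simp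
    also have "hi m = lo (Suc m)" using assms(2,3) Suc.prems by simp
    finally show ?thesis by simp
  qed
qed

text \<open>The least index whose upper end reaches \<open>x\<close> works. Its predecessor, if
  there is one, ends below \<open>x\<close>, and that end is the lower end of the chosen interval;
  for index 1 the assumption on \<open>lo 1\<close> takes over.\<close>

lemma consecutive_intervals_cover:
  fixes lo hi :: "nat \<Rightarrow> real"
  assumes "\<forall>m\<in>{1..<r}. hi m = lo (Suc m)" and "1 \<le> r" "lo 1 \<le> x" "x \<le> hi r"
  obtains m where "m \<in> {1..r}" "lo m \<le> x" "x \<le> hi m"
proof -
  define m where "m = (LEAST m. 1 \<le> m \<and> x \<le> hi m)"
  have m: "1 \<le> m" "x \<le> hi m"
    using LeastI[of "\<lambda>m. 1 \<le> m \<and> x \<le> hi m" r] assms by (auto simp: m_def)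
  have "m \<le> r" using assms by (auto simp: m_def intro: Least_le)
  have "lo m \<le> x"
  proof (cases "m = 1")
    case True
    then show ?thesis using assms by simp
  next
    case False
    then have "\<not> (1 \<le> m - 1 \<and> x \<le> hi (m - 1))"
      using m(1) unfolding m_def by (intro not_less_Least) simp
    then have "hi (m - 1) < x" using m(1) False by auto
    moreover have "hi (m - 1) = lo (Suc (m - 1))"
      using m(1) False \<open>m \<le> r\<close> by (intro bspec[OF assms(1)]) auto
    ultimately show ?thesis using m(1) by simp
  qed
  then show ?thesis using that m \<open>m \<le> r\<close> by auto
qed

text \<open>The flow equation of an edge involves the sign variable of the reversed edge, so
  recovery must be available there too.\<close>

lemma sym_int_pipes:
  assumes "is_network D"
  shows "sym (int_pipes D)"
proof -
  have pipes: "sym (pipes D)" using assms by (simp only: is_network_def)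
  have tie: "(j, i) \<in> tie_pipes D" if ij: "(i, j) \<in> tie_pipes D" for i j
  proof -
    obtain a b where ab: "a \<in> {1..n_areas D}" "b \<in> {1..n_areas D}" "a \<noteq> b"
      "i \<in> node_area D a" "j \<in> node_area D b"
      using ij unfolding tie_pipes_def by blast
    have "(j, i) \<in> pipes D"
      using ij symD[OF pipes, of i j] by (simp add: tie_pipes_def)
    moreover have "\<exists>a\<in>{1..n_areas D}. \<exists>b\<in>{1..n_areas D}.
        a \<noteq> b \<and> j \<in> node_area D a \<and> i \<in> node_area D b"
      \<comment> \<open>Reversing the edge swaps the two areas that witness a tie.\<close>
      by (intro bexI[of _ b] bexI[of _ a] conjI ab not_sym[OF ab(3)])
    ultimately show ?thesis by (simp add: tie_pipes_def)
  qed
  show ?thesis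
  proof (rule symI)
    fix i j assume "(i, j) \<in> int_pipes D"
    then show "(j, i) \<in> int_pipes D"
      using symD[OF pipes, of i j] tie[of j i] unfolding int_pipes_def by blast
  qed
qed

lemma int_pipes_subset_nodes:
  assumes "is_network D"
  shows "int_pipes D \<subseteq> nodes D \<times> nodes D"
proof -
  have "pipes D \<subseteq> nodes D \<times> nodes D" using assms by (simp only: is_network_def)
  then show ?thesis by (auto simp: int_pipes_def)
qed

lemma finite_int_pipes:
  assumes "is_network D"
  shows "finite (int_pipes D)"
proof -
  have "finite (nodes D)" using assms by (simp only: is_network_def)
  then show ?thesis using int_pipes_subset_nodes[OF assms] by (blast intro: finite_subset)
qed

lemma is_network_pieces:
  assumes "is_network D" "e \<in> int_pipes D"
  shows "1 \<le> pieces D" "piece_lo D e 1 = - phi_max D e" "piece_hi D e (pieces D) = phi_max D e"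
    "\<forall>m\<in>{1..pieces D}. piece_lo D e m < piece_hi D e m"
    "\<forall>m\<in>{1..<pieces D}. piece_hi D e m = piece_lo D e (Suc m)"
  using assms by (simp_all add: is_network_def)

text \<open>The breakpoints climb from \<open>- phi_max D e\<close> to \<open>phi_max D e\<close>
  through at least one piece, each of positive length.\<close>

lemma phi_max_pos:
  assumes "is_network D" "e \<in> int_pipes D"
  shows "0 < phi_max D e"
proof -
  note p = is_network_pieces[OF assms]
  have "piece_lo D e 1 < piece_hi D e (pieces D)"
  proof (cases "pieces D = 1")
    case True
    then show ?thesis using p by simp
  next
    case False
    then have "piece_hi D e 1 \<le> piece_lo D e (pieces D)"
      using p by (intro consecutive_intervals_ordered[OF p(4,5)]) auto
    moreover have "piece_lo D e 1 < piece_hi D e 1"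
      "piece_lo D e (pieces D) < piece_hi D e (pieces D)"
      using p(1) by (auto intro!: bspec[OF p(4)])
    ultimately show ?thesis by linarith
  qed
  then show ?thesis using p by simp
qed

text \<open>Internal pipelines carry no explicit flow bound; it is hidden in the big-M sign
  constraints and survives relaxation. For fractional \<open>d\<close> the right-hand sides
  \<open>phi_max D e * (1 - d)\<close> and \<open>tol D * (1 - d) - phi_max D e * d\<close> still
  lie below \<open>phi_max D e\<close> and above \<open>- phi_max D e\<close> respectively.\<close>

lemma flow_sign_bounds:
  assumes "flow_sign D e f d" "d \<in> {0..1}" "0 < phi_max D e" "0 < tol D"
  shows "- phi_max D e \<le> f" "f \<le> phi_max D e"
proof -
  have "phi_max D e * (1 - d) \<le> phi_max D e" "phi_max D e * d \<le> phi_max D e" "0 \<le> tol D * (1 - d)"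
    using assms by (auto simp: mult_left_le algebra_simps)
  then show "- phi_max D e \<le> f" "f \<le> phi_max D e"
    using assms(1) by (auto simp: flow_sign_def algebra_simps)
qed

lemma J_psi_zeroD:
  assumes "J_psi D \<phi> z \<psi> = 0" "finite (int_pipes D)" "(i, j) \<in> int_pipes D"
  shows "(2 * dpsi (z (i, j)) - 1) * (\<psi> i - \<psi> j) =
    (\<Sum>m=1..pieces D. delta (z (i, j)) m * (pwa_a D (i, j) m * \<phi> (i, j) + pwa_b D (i, j) m))"
    (is "?l = ?r")
proof -
  have "\<bar>?l - ?r\<bar> \<le> J_psi D \<phi> z \<psi>"
    unfolding J_psi_def using assms(2,3)
    by (intro Max_ge) (auto intro!: rev_image_eqI[of "(i, j)"])
  then show ?thesis using assms(1) by simp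
qed

lemma recovered_delta_single:
  assumes "is_network D" "recovered_binaries D \<phi> z" "nondegenerate_flow D \<phi>"
    and e: "e \<in> int_pipes D" and "- phi_max D e \<le> \<phi> e" "\<phi> e \<le> phi_max D e"
  obtains k where "k \<in> {1..pieces D}" "piece_lo D e k \<le> \<phi> e" "\<phi> e \<le> piece_hi D e k"
    "\<And>m. m \<in> {1..pieces D} \<Longrightarrow> delta (z e) m = (if m = k then 1 else 0)"
proof -
  note p = is_network_pieces[OF assms(1) e]
  have nd: "\<phi> e \<noteq> piece_hi D e m" if "m \<in> {1..<pieces D}" for m
    using assms(3) e that by (simp add: nondegenerate_flow_def)
  \<comment> \<open>A flow in both pieces would satisfy \<open>hi l\<close> \<le>
    \<open>lo m\<close> \<le> flow \<le> \<open>hi l\<close>, hence equal the breakpoint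
    \<open>hi l\<close>, which is interior since \<open>l < pieces D\<close>.\<close>
  have lt: "\<not> (\<phi> e \<le> piece_hi D e l \<and> piece_lo D e m \<le> \<phi> e)"
    if "1 \<le> l" "l < m" "m \<le> pieces D" for l m
    using consecutive_intervals_ordered[OF p(4,5) that] nd[of l] that by auto
  obtain k where k: "k \<in> {1..pieces D}" "piece_lo D e k \<le> \<phi> e" "\<phi> e \<le> piece_hi D e k"
    using consecutive_intervals_cover[OF p(5,1), of "\<phi> e"] assms(5,6) p(2,3) by auto
  show ?thesis
  proof
    show "k \<in> {1..pieces D}" "piece_lo D e k \<le> \<phi> e" "\<phi> e \<le> piece_hi D e k" by fact+
    fix m assume m: "m \<in> {1..pieces D}"
    have "(piece_lo D e m \<le> \<phi> e \<and> \<phi> e \<le> piece_hi D e m) = (m = k)"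
      using lt[of m k] lt[of k m] k m by (cases m k rule: linorder_cases) auto
    then show "delta (z e) m = (if m = k then 1 else 0)"
      using assms(2) e m by (simp add: recovered_binaries_def)
  qed
qed

lemma two_stage_output_simps [simp]:
  "pdg (two_stage_output u z \<psi>) = pdg u"
  "dgu (two_stage_output u z \<psi>) = dgu u"
  "theta (two_stage_output u z \<psi>) = theta u"
  "gs (two_stage_output u z \<psi>) = gs u"
  "flow (two_stage_output u z \<psi>) = flow u"
  "psi (two_stage_output u z \<psi>) = \<psi>"
  "ypsi (two_stage_output u z \<psi>) (i, j) = dpsi (z (i, j)) * \<psi> i"
  "ym (two_stage_output u z \<psi>) e m = delta (z e) m * flow u e"
  "zvar (two_stage_output u z \<psi>) = z"
  by (simp_all add: two_stage_output_def)

lemma cost_two_stage_output: "cost D (two_stage_output u z \<psi>) = cost D u"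
  by (simp add: cost_def)

text \<open>The set enters only through the membership tests in \<open>zvec_in\<close>. With {0, 1}
  inside [0, 1], the relaxed optimum bounds the cost of every binary point from below.\<close>

lemma feasible_mono:
  assumes "feasible D S u" "S \<subseteq> T"
  shows "feasible D T u"
  using assms unfolding feasible_def zvec_in_def by blast

lemma feasible_two_stage_output:
  assumes net: "is_network D"
    and feas: "feasible D {0..1} u"
    and rec: "recovered_binaries D (flow u) z"
    and box: "psi_box D \<psi>"
    and tol: "tol_small D (flow u) \<psi>"
    and nd: "nondegenerate_flow D (flow u)"
    and pos: "pwa_positive_at D (flow u)"
    and J: "J_psi D (flow u) z \<psi> = 0"
  shows "feasible D {0, 1} (two_stage_output u z \<psi>)"
proof -
  have tol_pos: "0 < tol D" using net by (simp add: is_network_def)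
  have d: "dpsi (z e) = (if 0 \<le> flow u e then 1 else 0)" if "e \<in> int_pipes D" for e
    using rec that by (simp add: recovered_binaries_def)
  have f: "- phi_max D e \<le> flow u e" "flow u e \<le> phi_max D e" if e: "e \<in> int_pipes D" for e
  proof -
    have "flow_sign D e (flow u e) (dpsi (zvar u e))" "dpsi (zvar u e) \<in> {0..1}"
      using feas e by (auto simp: feasible_def flow_inequalities_def zvec_in_def)
    then show "- phi_max D e \<le> flow u e" "flow u e \<le> phi_max D e"
      using flow_sign_bounds phi_max_pos[OF net e] tol_pos by blast+
  qed
  have anti: "flow u (i, j) + flow u (j, i) = 0" if "(i, j) \<in> int_pipes D" for i j
    using feas that by (auto simp: feasible_def flow_equalities_def)
  have edge: "(\<Sum>m=1..pieces D. pwa_a D (i, j) m * (delta (z (i, j)) m * flow u (i, j))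
          + pwa_b D (i, j) m * delta (z (i, j)) m)
        = 2 * (dpsi (z (i, j)) * \<psi> i) + 2 * (dpsi (z (j, i)) * \<psi> j) - \<psi> i - \<psi> j"
      "(\<Sum>m=1..pieces D. delta (z (i, j)) m) = 1"
      "pressure_sign D (i, j) \<psi> (dpsi (z (i, j)))"
      "flow_sign D (i, j) (flow u (i, j)) (dpsi (z (i, j)))"
      "pressure_product D i \<psi> (dpsi (z (i, j))) (dpsi (z (i, j)) * \<psi> i)"
    if ij: "(i, j) \<in> int_pipes D" for i j
  proof -
    have ji: "(j, i) \<in> int_pipes D" using sym_int_pipes[OF net] ij by (meson symD)
    have nodes: "i \<in> nodes D" "j \<in> nodes D" using int_pipes_subset_nodes[OF net] ij by auto
    have bi: "psi_min D i \<le> \<psi> i" "\<psi> i \<le> psi_max D i" "psi_min D j \<le> \<psi> j" "\<psi> j \<le> psi_max D j"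
      using box nodes by (auto simp: psi_box_def)
    have nz: "flow u (i, j) \<noteq> 0" using nd ij by (simp add: nondegenerate_flow_def)
    \<comment> \<open>At zero flow both recovered signs would be 1, so the nonzero flow is essential
      here.\<close>
    have dd: "dpsi (z (j, i)) = 1 - dpsi (z (i, j))"
      using d[OF ij] d[OF ji] anti[OF ij] nz by auto
    have tols: "\<psi> i < \<psi> j \<Longrightarrow> tol D \<le> \<psi> j - \<psi> i"
      "flow u (i, j) < 0 \<Longrightarrow> tol D \<le> - flow u (i, j)"
      using tol ij by (auto simp: tol_small_def)
    note gas_eq = J_psi_zeroD[OF J finite_int_pipes[OF net] ij]
    show "(\<Sum>m=1..pieces D. pwa_a D (i, j) m * (delta (z (i, j)) m * flow u (i, j))
          + pwa_b D (i, j) m * delta (z (i, j)) m)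
        = 2 * (dpsi (z (i, j)) * \<psi> i) + 2 * (dpsi (z (j, i)) * \<psi> j) - \<psi> i - \<psi> j"
      \<comment> \<open>After substituting \<open>dd\<close>, the right-hand side becomes
        \<open>(2 * dpsi (z (i, j)) - 1) * (\<psi> i - \<psi> j)\<close>.\<close>
      using gas_eq by (simp add: dd algebra_simps)
    obtain k where k: "k \<in> {1..pieces D}" "piece_lo D (i, j) k \<le> flow u (i, j)"
        "flow u (i, j) \<le> piece_hi D (i, j) k"
      and delta: "\<And>m. m \<in> {1..pieces D} \<Longrightarrow> delta (z (i, j)) m = (if m = k then 1 else 0)"
      using recovered_delta_single[OF net rec nd ij f[OF ij]] by blast
    have "(\<Sum>m=1..pieces D. delta (z (i, j)) m) = (\<Sum>m=1..pieces D. if m = k then 1 else 0)"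
      using delta by (intro sum.cong) auto
    then show "(\<Sum>m=1..pieces D. delta (z (i, j)) m) = 1" using k(1) by simp
    have "(\<Sum>m=1..pieces D. delta (z (i, j)) m * (pwa_a D (i, j) m * flow u (i, j) + pwa_b D (i, j) m))
      = (\<Sum>m=1..pieces D. if m = k then pwa_a D (i, j) m * flow u (i, j) + pwa_b D (i, j) m else 0)"
      using delta by (intro sum.cong) auto
    also have "\<dots> = pwa_a D (i, j) k * flow u (i, j) + pwa_b D (i, j) k" using k(1) by simp
    also have "\<dots> > 0" using pos ij k by (simp add: pwa_positive_at_def)
    finally have order: "(2 * dpsi (z (i, j)) - 1) * (\<psi> i - \<psi> j) > 0" using gas_eq by simp
    \<comment> \<open>Positivity gives a strict pressure order: downward along the edge if
      \<open>dpsi\<close> is 1, upward if it is 0. In the second case \<open>tols(1)\<close> widens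
      the strict gap to the required margin.\<close>
    then show "pressure_sign D (i, j) \<psi> (dpsi (z (i, j)))"
      using d[OF ij] bi tols(1) by (cases "0 \<le> flow u (i, j)") (auto simp: pressure_sign_def)
    show "flow_sign D (i, j) (flow u (i, j)) (dpsi (z (i, j)))"
      using d[OF ij] f[OF ij] tols(2) by (cases "0 \<le> flow u (i, j)") (auto simp: flow_sign_def)
    show "pressure_product D i \<psi> (dpsi (z (i, j))) (dpsi (z (i, j)) * \<psi> i)"
      using d[OF ij] bi by (simp add: pressure_product_def)
  qed
  have delta: "delta (z e) m \<in> {0, 1}" if "e \<in> int_pipes D" "m \<in> {1..pieces D}" for e m
    using rec that by (simp add: recovered_binaries_def)
  \<comment> \<open>For each binary value of \<open>delta\<close>, two of the four inequalities are
    trivial and the other two are the flow bounds \<open>f\<close>.\<close>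
  have "flow_product D e (flow u e) (delta (z e) m) (delta (z e) m * flow u e)"
    if "e \<in> int_pipes D" "m \<in> {1..pieces D}" for e m
    using delta[OF that] f[OF that(1)] by (auto simp: flow_product_def)
  moreover have "piece_select D e m (flow u e) (z e)"
    if "e \<in> int_pipes D" "m \<in> {1..pieces D}" for e m
    using rec that by (simp add: recovered_binaries_def)
  ultimately have "flow_inequalities D (two_stage_output u z \<psi>)"
    using edge by (auto simp: flow_inequalities_def)
  moreover have "flow_equalities D (two_stage_output u z \<psi>)"
    using edge anti by (auto simp: flow_equalities_def)
  moreover have "gas_constraints D (two_stage_output u z \<psi>)"
    using feas box by (simp add: feasible_def gas_constraints_def)
  moreover have "power_constraints D (two_stage_output u z \<psi>)"
    using feas by (simp add: feasible_def power_constraints_def)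
  moreover have "\<forall>e\<in>int_pipes D. zvec_in D {0, 1} (z e)"
    using rec by (simp add: recovered_binaries_def zvec_in_def)
  ultimately show ?thesis by (simp add: feasible_def)
qed

theorem proposition1:
  fixes D :: "('g, 'b, 's, 'n) network"
    and u :: "('g, 'b, 's, 'n) dvars"
    and z :: "'n \<times> 'n \<Rightarrow> zvec"
    and \<psi> :: "'n \<Rightarrow> real"
  assumes "is_network D"
    and "CVX_solution D u"
    and "recovered_binaries D (flow u) z"
    and "J_psi_minimizer D (flow u) z \<psi>"
    and "tol_small D (flow u) \<psi>"
    and "nondegenerate_flow D (flow u)"
    and "pwa_positive_at D (flow u)"
    and "J_psi D (flow u) z \<psi> = 0"
  shows "MI_solution D (two_stage_output u z \<psi>)"
proof -
  have u: "feasible D {0..1} u" "\<And>v. feasible D {0..1} v \<Longrightarrow> cost D u \<le> cost D v"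
    using assms(2) by (auto simp: CVX_solution_def optimal_def)
  have "psi_box D \<psi>" using assms(4) by (simp add: J_psi_minimizer_def)
  then have "feasible D {0, 1} (two_stage_output u z \<psi>)"
    using feasible_two_stage_output assms u(1) by blast
  moreover have "cost D u \<le> cost D v" if "feasible D {0, 1} v" for v
    using u(2) feasible_mono[OF that, of "{0..1}"] by simp
  ultimately show ?thesis
    by (simp add: MI_solution_def optimal_def cost_two_stage_output)
qed

end
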